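(* Let $n\ge 1$ and suppose that the random vector $X=(X_1,\dots,X_n)\in\{0,1\}^n$ has an $\mathrm{MTP}_2$ law. Then $$\sum_{1\le i<j\le n}\mathbb{E}\left[\left|\mathrm{Cov}\left(X_i,X_j\,\middle|\,X_{[n]\setminus\{i,j\}}\right)\right|\right]\le\frac n2.$$
   Context: Write $[n]=\{1,\dots,n\}$. A probability measure $\mu$ on $\{0,1\}^n$ is multivariate totally positive of order two ($\mathrm{MTP}_2$) if $\mu(\min\{x,y\})\,\mu(\max\{x,y\})\ge\mu(x)\mu(y)$ for all $x,y\in\{0,1\}^n$, where $\min$ and $\max$ are taken coordinatewise. The measure $\mu$ is not assumed to have full support. For $A\subset[n]$, $X_A=(X_k)_{k\in A}$. $\mathrm{Cov}(X_i,X_j\mid X_{[n]\setminus\{i,j\}})$ is the conditional covariance of $X_i$ and $X_j$ given all the other coordinates, i.e. the random variable which, on the event $X_{[n]\setminus\{i,j\}}=z$ (of positive probability), equals the covariance of $X_i,X_j$ under the conditional law given that event. The outer expectation is over $X_{[n]\setminus\{i,j\}}$. *)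

theory Defs
  imports "HOL-Probability.Probability"
begin

text \<open>Vectors indexed by \<open>{1..n}\<close> are extensional functions; the entries are real numbers so that
  covariances can be taken directly.\<close>

definition cube :: "nat \<Rightarrow> (nat \<Rightarrow> real) set" where
  "cube n = ({1..n} \<rightarrow>\<^sub>E {0, 1})"

definition vec_min :: "nat \<Rightarrow> (nat \<Rightarrow> real) \<Rightarrow> (nat \<Rightarrow> real) \<Rightarrow> nat \<Rightarrow> real" where
  "vec_min n x y = (\<lambda>k\<in>{1..n}. min (x k) (y k))"

definition vec_max :: "nat \<Rightarrow> (nat \<Rightarrow> real) \<Rightarrow> (nat \<Rightarrow> real) \<Rightarrow> nat \<Rightarrow> real" where
  "vec_max n x y = (\<lambda>k\<in>{1..n}. max (x k) (y k))"

definition MTP2 :: "nat \<Rightarrow> (nat \<Rightarrow> real) measure \<Rightarrow> bool" where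
  "MTP2 n \<mu> \<longleftrightarrow> (\<forall>x\<in>cube n. \<forall>y\<in>cube n.
     measure \<mu> {vec_min n x y} * measure \<mu> {vec_max n x y} \<ge> measure \<mu> {x} * measure \<mu> {y})"

definition covariance :: "'w measure \<Rightarrow> ('w \<Rightarrow> real) \<Rightarrow> ('w \<Rightarrow> real) \<Rightarrow> real" where
  "covariance M Y Z = (LINT \<omega>|M. (Y \<omega> - (LINT \<eta>|M. Y \<eta>)) * (Z \<omega> - (LINT \<eta>|M. Z \<eta>)))"

text \<open>The conditional law given an event \<open>E\<close> of positive probability is \<open>uniform_measure M E\<close>,
  which sends \<open>A\<close> to \<open>M (A \<inter> E) / M E\<close>.  Outcomes \<open>\<omega>\<close> for which the conditioning event below is
  null form a null set, because the conditioning vector takes finitely many values.\<close>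

definition cond_cov ::
  "'w measure \<Rightarrow> nat \<Rightarrow> ('w \<Rightarrow> nat \<Rightarrow> real) \<Rightarrow> nat \<Rightarrow> nat \<Rightarrow> 'w \<Rightarrow> real" where
  "cond_cov M n X i j \<omega> =
     covariance
       (uniform_measure M
         {\<eta> \<in> space M. restrict (X \<eta>) ({1..n} - {i, j}) = restrict (X \<omega>) ({1..n} - {i, j})})
       (\<lambda>\<eta>. X \<eta> i) (\<lambda>\<eta>. X \<eta> j)"

end

theory Submission
  imports Defs
begin

text \<open>
  Let \<open>S\<close> be the random set of ones, and pin every coordinate independently with probability \<open>p\<close>;
  write \<open>A\<close> for the set of pinned coordinates and \<open>V p\<close> for the mean of \<open>Var (|S| | X\<^sub>A)\<close>.
  Pinning one more coordinate \<open>k\<close> lowers the mean conditional variance by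
  \<open>E [c\<^sub>k\<^sup>2 / Var (X\<^sub>k | X\<^sub>A)] \<ge> 4 E c\<^sub>k\<^sup>2\<close>, where \<open>c\<^sub>k = Cov (|S|, X\<^sub>k | X\<^sub>A)\<close>. As the \<open>c\<^sub>k\<close> of the
  unpinned \<open>k\<close> sum to \<open>Var (|S| | X\<^sub>A)\<close>, the Cauchy--Schwarz inequality yields
  \<open>- V' p \<ge> 4 (V p)\<^sup>2 / (n (1 - p)\<^sup>2)\<close>, so \<open>1 / V p - 4 / (n (1 - p))\<close> is nondecreasing and
  \<open>V (1/2) \<le> n / 4\<close>. By the four functions theorem, \<open>E Cov (X\<^sub>i, X\<^sub>j | X\<^sub>A)\<close> decreases as \<open>A\<close> grows;
  since two given coordinates are both unpinned with probability \<open>1/4\<close>, the sum in question over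
  ordered pairs is at most \<open>4 V (1/2) \<le> n\<close>.
\<close>

subsection \<open>The four functions theorem\<close>

lemma sum_Pow_insert:
  fixes f :: "'a set \<Rightarrow> 'b::comm_monoid_add"
  assumes "finite A" "x \<notin> A"
  shows "sum f (Pow (insert x A)) = (\<Sum>S\<in>Pow A. f S + f (insert x S))"
proof -
  have "sum f (Pow (insert x A)) = sum f (Pow A) + sum f (insert x ` Pow A)"
    unfolding Pow_insert using assms by (intro sum.union_disjoint) auto
  also have "sum f (insert x ` Pow A) = (\<Sum>S\<in>Pow A. f (insert x S))"
    using assms by (subst sum.reindex) (auto simp: inj_on_def)
  finally show ?thesis by (simp add: sum.distrib)
qed

text \<open>This is the one-point case. The mixed products \<open>u\<close> and \<open>v\<close> are
  at most \<open>w\<close> and satisfy \<open>u * v <= w * (c0 * d1)\<close>, so expanding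
  \<open>0 <= (w - u) * (w - v)\<close> bounds \<open>u + v\<close>.\<close>

lemma four_functions_step:
  fixes a0 a1 b0 b1 c0 c1 d0 d1 :: real
  assumes nn: "0 \<le> a0" "0 \<le> a1" "0 \<le> b0" "0 \<le> b1" "0 \<le> c0" "0 \<le> c1" "0 \<le> d0" "0 \<le> d1"
    and le: "a0 * b0 \<le> c0 * d0" "a0 * b1 \<le> c1 * d0" "a1 * b0 \<le> c1 * d0" "a1 * b1 \<le> c1 * d1"
  shows "(a0 + a1) * (b0 + b1) \<le> (c0 + c1) * (d0 + d1)"
proof -
  define u v w where "u = a0 * b1" and "v = a1 * b0" and "w = c1 * d0"
  have "u + v \<le> w + c0 * d1"
  proof (cases "w = 0")
    case True
    then show ?thesis using le nn unfolding u_def v_def w_def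
      by (smt (verit) mult_nonneg_nonneg)
  next
    case False
    then have w: "w > 0" using nn unfolding w_def by (simp add: less_le)
    have "u * v = (a0 * b0) * (a1 * b1)" by (simp add: u_def v_def)
    also have "\<dots> \<le> (c0 * d0) * (c1 * d1)" by (rule mult_mono[OF le(1,4)]) (use nn in auto)
    also have "\<dots> = w * (c0 * d1)" by (simp add: w_def)
    finally have "u * v \<le> w * (c0 * d1)" .
    moreover have "0 \<le> (w - u) * (w - v)" using le by (auto simp: u_def v_def w_def)
    ultimately have "w * (u + v) \<le> w * (w + c0 * d1)" by (simp add: algebra_simps)
    then show ?thesis using w by simp
  qed
  then show ?thesis using le by (simp add: u_def v_def w_def algebra_simps)
qed

text \<open>The Ahlswede-Daykin inequality, by induction on the ground set: summing out
  \<open>x\<close> in all four functions preserves the pointwise hypothesis, by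
  \<open>four_functions_step\<close>.\<close>

lemma four_functions:
  fixes \<alpha> \<beta> \<gamma> \<delta> :: "'a set \<Rightarrow> real"
  assumes "finite N"
    and "\<And>S. S \<subseteq> N \<Longrightarrow> 0 \<le> \<alpha> S" "\<And>S. S \<subseteq> N \<Longrightarrow> 0 \<le> \<beta> S"
    and "\<And>S. S \<subseteq> N \<Longrightarrow> 0 \<le> \<gamma> S" "\<And>S. S \<subseteq> N \<Longrightarrow> 0 \<le> \<delta> S"
    and "\<And>S T. S \<subseteq> N \<Longrightarrow> T \<subseteq> N \<Longrightarrow> \<alpha> S * \<beta> T \<le> \<gamma> (S \<union> T) * \<delta> (S \<inter> T)"
  shows "sum \<alpha> (Pow N) * sum \<beta> (Pow N) \<le> sum \<gamma> (Pow N) * sum \<delta> (Pow N)"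
  using assms
proof (induction N arbitrary: \<alpha> \<beta> \<gamma> \<delta> rule: finite_induct)
  case empty
  then show ?case using empty(5)[of "{}" "{}"] by simp
next
  case (insert x N)
  note nn = insert.prems(1-4) and le = insert.prems(5)
  show ?case unfolding sum_Pow_insert[OF insert.hyps]
  proof (rule insert.IH)
    fix S T assume ST: "S \<subseteq> N" "T \<subseteq> N"
    then have sub: "S \<subseteq> insert x N" "T \<subseteq> insert x N" "insert x S \<subseteq> insert x N"
      "insert x T \<subseteq> insert x N" and x: "x \<notin> S" "x \<notin> T" using insert.hyps by auto
    show "(\<alpha> S + \<alpha> (insert x S)) * (\<beta> T + \<beta> (insert x T))
      \<le> (\<gamma> (S \<union> T) + \<gamma> (insert x (S \<union> T))) * (\<delta> (S \<inter> T) + \<delta> (insert x (S \<inter> T)))"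
    proof (rule four_functions_step)
      show "\<alpha> S * \<beta> T \<le> \<gamma> (S \<union> T) * \<delta> (S \<inter> T)" using le[OF sub(1,2)] .
      show "\<alpha> S * \<beta> (insert x T) \<le> \<gamma> (insert x (S \<union> T)) * \<delta> (S \<inter> T)"
        using le[OF sub(1,4)] x by simp
      show "\<alpha> (insert x S) * \<beta> T \<le> \<gamma> (insert x (S \<union> T)) * \<delta> (S \<inter> T)"
        using le[OF sub(3,2)] x by simp
      show "\<alpha> (insert x S) * \<beta> (insert x T) \<le> \<gamma> (insert x (S \<union> T)) * \<delta> (insert x (S \<inter> T))"
        using le[OF sub(3,4)] by simp
    qed (use ST in \<open>auto intro!: nn\<close>)
  qed (auto intro!: add_nonneg_nonneg nn)
qed

subsection \<open>Averages over random subsets\<close>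

text \<open>The expectation of \<open>v\<close> at a random subset of \<open>N\<close> containing
  each point independently with probability \<open>p\<close>. The argument \<open>p\<close> comes
  last and ranges over all reals, so that \<open>bernoulli_avg N v\<close> can be
  differentiated.\<close>

definition bernoulli_avg :: "'a set \<Rightarrow> ('a set \<Rightarrow> real) \<Rightarrow> real \<Rightarrow> real" where
  "bernoulli_avg N v p = (\<Sum>A\<in>Pow N. p ^ card A * (1 - p) ^ card (N - A) * v A)"

lemma bernoulli_avg_empty [simp]: "bernoulli_avg {} v p = v {}"
  by (simp add: bernoulli_avg_def)

text \<open>Conditions on whether the random set contains \<open>x\<close>; the inductions on
  \<open>N\<close> below rest on this recursion.\<close>

lemma bernoulli_avg_insert:
  assumes "finite N" "x \<notin> N"
  shows "bernoulli_avg (insert x N) v p =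
    (1 - p) * bernoulli_avg N v p + p * bernoulli_avg N (\<lambda>A. v (insert x A)) p"
  unfolding bernoulli_avg_def sum_Pow_insert[OF assms] sum_distrib_left sum.distrib[symmetric]
proof (intro sum.cong refl, goal_cases)
  case (1 A)
  then have "A \<subseteq> N" "finite A" "x \<notin> A" using assms finite_subset by auto
  moreover from this have "insert x N - A = insert x (N - A)" "insert x N - insert x A = N - A"
    using assms by auto
  ultimately show ?case using assms by simp
qed

lemma bernoulli_avg_add:
  "bernoulli_avg N (\<lambda>A. v A + w A) p = bernoulli_avg N v p + bernoulli_avg N w p"
  by (simp add: bernoulli_avg_def sum.distrib distrib_left)

lemma bernoulli_avg_diff:
  "bernoulli_avg N (\<lambda>A. v A - w A) p = bernoulli_avg N v p - bernoulli_avg N w p"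
  by (simp add: bernoulli_avg_def sum_subtractf right_diff_distrib)

lemma bernoulli_avg_cmult: "bernoulli_avg N (\<lambda>A. c * v A) p = c * bernoulli_avg N v p"
  by (simp add: bernoulli_avg_def sum_distrib_left mult_ac)

lemma bernoulli_avg_mono:
  assumes "0 \<le> p" "p \<le> 1" "\<And>A. A \<subseteq> N \<Longrightarrow> v A \<le> w A"
  shows "bernoulli_avg N v p \<le> bernoulli_avg N w p"
  unfolding bernoulli_avg_def using assms by (intro sum_mono mult_left_mono) auto

lemma bernoulli_avg_cong:
  assumes "\<And>A. A \<subseteq> N \<Longrightarrow> v A = w A"
  shows "bernoulli_avg N v p = bernoulli_avg N w p"
  unfolding bernoulli_avg_def using assms by (intro sum.cong) auto

lemma bernoulli_avg_one: "finite N \<Longrightarrow> bernoulli_avg N (\<lambda>_. 1) p = 1"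
  by (induction N rule: finite_induct) (simp_all add: bernoulli_avg_insert)

lemma bernoulli_avg_card_compl:
  "finite N \<Longrightarrow> bernoulli_avg N (\<lambda>A. real (card (N - A))) p = real (card N) * (1 - p)"
proof (induction N rule: finite_induct)
  case (insert x N)
  have "bernoulli_avg N (\<lambda>A. real (card (insert x N - A))) p
      = bernoulli_avg N (\<lambda>A. real (card (N - A)) + 1) p"
  proof (rule bernoulli_avg_cong)
    fix A assume "A \<subseteq> N"
    then have "insert x N - A = insert x (N - A)" using insert by auto
    then show "real (card (insert x N - A)) = real (card (N - A)) + 1" using insert by simp
  qed
  moreover have "bernoulli_avg N (\<lambda>A. real (card (insert x N - insert x A))) p
      = bernoulli_avg N (\<lambda>A. real (card (N - A))) p"
    using insert by (intro bernoulli_avg_cong arg_cong[of _ _ "\<lambda>X. real (card X)"]) auto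
  ultimately have "bernoulli_avg (insert x N) (\<lambda>A. real (card (insert x N - A))) p
      = (1 - p) * (real (card N) * (1 - p) + 1) + p * (real (card N) * (1 - p))"
    using insert by (simp add: bernoulli_avg_insert bernoulli_avg_add bernoulli_avg_one)
  also have "\<dots> = real (card (insert x N)) * (1 - p)" using insert.hyps by (simp add: algebra_simps)
  finally show ?case .
qed simp

text \<open>The Margulis-Russo formula. The derivative is the mean of
  \<open>v (insert k A) - v (A - {k})\<close> summed over all \<open>k\<close>. A given
  \<open>k\<close> lies outside \<open>A\<close> with probability \<open>1 - p\<close>,
  independently of the other points, so restricting the sum to \<open>N - A\<close> is offset by
  dividing by \<open>1 - p\<close>.\<close>

lemma has_real_derivative_bernoulli_avg:
  assumes "finite N" "p \<noteq> 1"
  shows "(bernoulli_avg N v has_real_derivative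
    bernoulli_avg N (\<lambda>A. \<Sum>k\<in>N - A. v (insert k A) - v A) p / (1 - p)) (at p)"
  using assms(1)
proof (induction N arbitrary: v rule: finite_induct)
  case empty
  have "bernoulli_avg {} v = (\<lambda>_. v {})" by auto
  then show ?case by simp
next
  case (insert x N)
  let ?D = "\<lambda>v. bernoulli_avg N (\<lambda>A. \<Sum>k\<in>N - A. v (insert k A) - v A) p"
  let ?v = "\<lambda>A. v (insert x A)"
  have eq: "bernoulli_avg (insert x N) v =
      (\<lambda>p. (1 - p) * bernoulli_avg N v p + p * bernoulli_avg N ?v p)"
    using insert.hyps by (auto simp: bernoulli_avg_insert)
  have "bernoulli_avg N (\<lambda>A. \<Sum>k\<in>insert x N - A. v (insert k A) - v A) p
      = bernoulli_avg N (\<lambda>A. (\<Sum>k\<in>N - A. v (insert k A) - v A) + (?v A - v A)) p"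
  proof (rule bernoulli_avg_cong)
    fix A assume "A \<subseteq> N"
    then have "insert x N - A = insert x (N - A)" using insert by auto
    then show "(\<Sum>k\<in>insert x N - A. v (insert k A) - v A)
        = (\<Sum>k\<in>N - A. v (insert k A) - v A) + (?v A - v A)"
      using insert.hyps by simp
  qed
  moreover have "bernoulli_avg N (\<lambda>A. \<Sum>k\<in>insert x N - insert x A. v (insert k (insert x A)) - ?v A) p
      = ?D ?v"
  proof (rule bernoulli_avg_cong)
    fix A assume "A \<subseteq> N"
    then have "insert x N - insert x A = N - A" using insert by auto
    then show "(\<Sum>k\<in>insert x N - insert x A. v (insert k (insert x A)) - ?v A)
        = (\<Sum>k\<in>N - A. ?v (insert k A) - ?v A)" by (simp add: insert_commute)
  qed
  ultimately have rhs: "bernoulli_avg (insert x N) (\<lambda>A. \<Sum>k\<in>insert x N - A. v (insert k A) - v A) p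
      = (1 - p) * (?D v + (bernoulli_avg N ?v p - bernoulli_avg N v p)) + p * ?D ?v"
    using insert.hyps by (simp add: bernoulli_avg_insert bernoulli_avg_add bernoulli_avg_diff)
  \<comment> \<open>Brings the expression produced by the product rule over the common denominator
    \<open>1 - p\<close>.\<close>
  have "r * (a / r) - b + (p * (c / r) + d) = (r * (a + (d - b)) + p * c) / r"
    if "r \<noteq> 0" for a b c d r :: real
    using that by (simp add: field_simps)
  from this[of "1 - p"] have quotient: "(1 - p) * (a / (1 - p)) - b + (p * (c / (1 - p)) + d)
      = ((1 - p) * (a + (d - b)) + p * c) / (1 - p)" for a b c d :: real
    using assms(2) by auto
  show ?case unfolding eq rhs quotient[symmetric]
    by (rule derivative_eq_intros insert.IH refl)+ simp
qed

lemma bernoulli_avg_half: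
  assumes "finite N"
  shows "bernoulli_avg N v (1 / 2) = (\<Sum>A\<in>Pow N. v A) / 2 ^ card N"
proof -
  have "(1 / 2 :: real) ^ card A * (1 - 1 / 2) ^ card (N - A) = 1 / 2 ^ card N" if "A \<subseteq> N" for A
  proof -
    have "card A + card (N - A) = card N"
      using assms that card_mono[OF assms that] by (simp add: card_Diff_subset finite_subset)
    then show ?thesis by (simp add: power_one_over flip: power_add)
  qed
  then show ?thesis
    unfolding bernoulli_avg_def sum_divide_distrib by (intro sum.cong) auto
qed

text \<open>Here \<open>s, t\<close> are the masses of \<open>X\<^sub>k = 0\<close> and \<open>X\<^sub>k = 1\<close>, and \<open>a, b\<close> the integrals of a function over
  these events, so that the right-hand side is the drop of its variance. The parameter \<open>c\<close>
  linearises the square of the covariance, which replaces the Cauchy--Schwarz inequality later on.\<close>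

lemma variance_drop_aux:
  fixes a b s t c :: real
  assumes "0 \<le> s" "0 \<le> t" "s = 0 \<Longrightarrow> a = 0" "t = 0 \<Longrightarrow> b = 0"
  shows "4 * (2 * c * (b - (a + b) * t / (s + t)) - c\<^sup>2 * (s + t))
    \<le> a * a / s + b * b / t - (a + b) * (a + b) / (s + t)"
proof -
  consider "s = 0" | "t = 0" | "s > 0" "t > 0" using assms(1,2) by linarith
  then show ?thesis
  proof cases
    \<comment> \<open>When one of the masses is 0, the pinned coordinate is constant: covariance and
      drop vanish, and only \<open>- 4 c^2 (s + t)\<close> remains on the left.\<close>
    case 1
    have "0 \<le> c\<^sup>2 * t" using assms by simp
    with 1 show ?thesis using assms(3,4) by (cases "t = 0") auto
  next
    case 2
    have "0 \<le> c\<^sup>2 * s" using assms by simp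
    with 2 show ?thesis using assms(3,4) by (cases "s = 0") auto
  next
    case 3
    define u where "u = s + t"
    define e where "e = (b * s - a * t) / u"
    have u: "u > 0" using 3 by (simp add: u_def)
    have e: "b - (a + b) * t / u = e"
      using u by (simp add: e_def u_def field_simps)
    have drop: "a * a / s + b * b / t - (a + b) * (a + b) / u = e\<^sup>2 * u / (s * t)"
      using 3 u unfolding e_def power2_eq_square
      by (simp add: u_def divide_simps) (simp add: algebra_simps)
    \<comment> \<open>Here \<open>s * t / u^2\<close> is the variance of a 0/1 variable, hence at
      most 1/4; this is the source of the constant 4.\<close>
    have bound: "4 * (e\<^sup>2 / u) \<le> e\<^sup>2 * u / (s * t)"
    proof -
      have "0 \<le> (s - t)\<^sup>2" by simp
      then have "4 * (s * t) \<le> u * u" by (simp add: u_def power2_eq_square algebra_simps)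
      then have "e\<^sup>2 * (4 * (s * t)) \<le> e\<^sup>2 * (u * u)" by (intro mult_left_mono) auto
      then show ?thesis using 3 u by (simp add: field_simps)
    qed
    \<comment> \<open>Completing the square; equality holds at \<open>c = e / u\<close>.\<close>
    have "2 * c * e - c\<^sup>2 * u \<le> e\<^sup>2 / u"
    proof -
      have "0 \<le> (e - c * u)\<^sup>2" by simp
      then have "(2 * c * e - c\<^sup>2 * u) * u \<le> e\<^sup>2"
        by (simp add: power2_eq_square algebra_simps)
      then show ?thesis using u by (simp add: pos_le_divide_eq)
    qed
    then have "4 * (2 * c * e - c\<^sup>2 * u) \<le> 4 * (e\<^sup>2 / u)" by simp
    also note bound
    also note drop[symmetric]
    finally show ?thesis unfolding u_def[symmetric] e .
  qed
qed

subsection \<open>Conditional covariances of log-supermodular measures\<close>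

text \<open>The MTP2 condition carried over to the law of the random set of ones. Zeros of
  \<open>m\<close> are allowed, so conditioning events can be null.\<close>

locale log_supermodular =
  fixes N :: "'a set" and m :: "'a set \<Rightarrow> real"
  assumes finite_N: "finite N"
    and m_nonneg: "0 \<le> m S"
    and sum_m: "sum m (Pow N) = 1"
    and supermodular: "S \<subseteq> N \<Longrightarrow> T \<subseteq> N \<Longrightarrow> m S * m T \<le> m (S \<union> T) * m (S \<inter> T)"
begin

text \<open>Left unnormalised, these integrals add up when the conditioning is refined, and they
  make sense for null events.\<close>

definition slice :: "'a set \<Rightarrow> 'a set \<Rightarrow> ('a set \<Rightarrow> real) \<Rightarrow> real" where
  "slice A T f = (\<Sum>S | S \<subseteq> N \<and> S \<inter> A = T. f S * m S)"

abbreviation mass :: "'a set \<Rightarrow> 'a set \<Rightarrow> real" where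
  "mass A T \<equiv> slice A T (\<lambda>_. 1)"

text \<open>For the random set \<open>S\<close> with law \<open>m\<close> this is the mean of the conditional covariance of
  \<open>f S\<close> and \<open>g S\<close> given \<open>S \<inter> A\<close>: the quotient is the expectation of the product of the conditional
  means on the event \<open>S \<inter> A = T\<close>, and it is \<open>0 / 0 = 0\<close> when this event is null.\<close>

definition condcov :: "'a set \<Rightarrow> ('a set \<Rightarrow> real) \<Rightarrow> ('a set \<Rightarrow> real) \<Rightarrow> real" where
  "condcov A f g =
    (\<Sum>T\<in>Pow A. slice A T (\<lambda>S. f S * g S) - slice A T f * slice A T g / mass A T)"

abbreviation ind :: "'a \<Rightarrow> 'a set \<Rightarrow> real" where
  "ind k S \<equiv> of_bool (k \<in> S)"

section \<open>Integrals over slices and their correlation inequalities\<close>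

lemma finite_slice [simp]: "finite {S. S \<subseteq> N \<and> P S}"
  using finite_N by simp

lemma slice_nonneg: "(\<And>S. S \<subseteq> N \<Longrightarrow> 0 \<le> f S) \<Longrightarrow> 0 \<le> slice A T f"
  unfolding slice_def using m_nonneg by (intro sum_nonneg) auto

lemma slice_add: "slice A T (\<lambda>S. f S + g S) = slice A T f + slice A T g"
  by (simp add: slice_def sum.distrib distrib_right)

lemma slice_sum: "slice A T (\<lambda>S. \<Sum>k\<in>K. f k S) = (\<Sum>k\<in>K. slice A T (f k))"
  unfolding slice_def sum_distrib_right by (rule sum.swap)

lemma slice_cong:
  "(\<And>S. S \<subseteq> N \<Longrightarrow> S \<inter> A = T \<Longrightarrow> f S = g S) \<Longrightarrow> slice A T f = slice A T g"
  unfolding slice_def by (intro sum.cong) auto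

lemma slice_mono:
  "(\<And>S. S \<subseteq> N \<Longrightarrow> S \<inter> A = T \<Longrightarrow> f S \<le> g S) \<Longrightarrow> slice A T f \<le> slice A T g"
  unfolding slice_def using m_nonneg by (intro sum_mono mult_right_mono) auto

lemma mass_nonneg: "0 \<le> mass A T"
  by (rule slice_nonneg) simp

text \<open>Makes the convention \<open>x / 0 = 0\<close> harmless: over a null event the numerators
  vanish as well.\<close>

lemma slice_eq_0_if_mass_eq_0:
  assumes "mass A T = 0"
  shows "slice A T f = 0"
proof -
  have "\<forall>S\<in>{S. S \<subseteq> N \<and> S \<inter> A = T}. 1 * m S = 0"
    using assms m_nonneg unfolding slice_def by (subst sum_nonneg_eq_0_iff[symmetric]) auto
  then show ?thesis unfolding slice_def by (intro sum.neutral) simp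
qed

text \<open>The law of total probability: what \<open>B\<close> reveals splits each event given by
  \<open>A\<close>.\<close>

lemma slice_refine:
  assumes "A \<subseteq> B" "finite B"
  shows "slice A T f = (\<Sum>U | U \<subseteq> B \<and> U \<inter> A = T. slice B U f)"
proof -
  have "slice A T f = (\<Sum>U | U \<subseteq> B \<and> U \<inter> A = T.
      \<Sum>S | S \<in> {S. S \<subseteq> N \<and> S \<inter> A = T} \<and> S \<inter> B = U. f S * m S)"
    unfolding slice_def using assms
    by (subst sum.group) auto
  also have "\<dots> = (\<Sum>U | U \<subseteq> B \<and> U \<inter> A = T. slice B U f)"
    unfolding slice_def using assms by (intro sum.cong refl) auto
  finally show ?thesis .
qed

lemma sum_slice: "finite A \<Longrightarrow> (\<Sum>T\<in>Pow A. slice A T f) = (\<Sum>S\<in>Pow N. f S * m S)"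
  using slice_refine[of "{}" A "{}" f] by (simp add: slice_def Pow_def)

lemma slice_insert:
  assumes "k \<notin> A" "T \<subseteq> A"
  shows "slice (insert k A) T f = slice A T (\<lambda>S. f S * (1 - ind k S))"
    and "slice (insert k A) (insert k T) f = slice A T (\<lambda>S. f S * ind k S)"
  unfolding slice_def by (rule sum.mono_neutral_cong_left; use assms in auto)+

text \<open>Unions of sets from the slices at \<open>T\<close> and \<open>U\<close> lie in the slice
  at \<open>T \<union> U\<close>, intersections in the one at \<open>T \<inter> U\<close>. Hence the
  four functions theorem applies to the functions times \<open>m\<close>, cut off outside their
  slices.\<close>

lemma slice_four_functions:
  assumes nn: "\<And>S. 0 \<le> f S" "\<And>S. 0 \<le> g S" "\<And>S. 0 \<le> h S" "\<And>S. 0 \<le> k S"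
    and le: "\<And>S S'. S \<subseteq> N \<Longrightarrow> S' \<subseteq> N \<Longrightarrow> f S * g S' \<le> h (S \<union> S') * k (S \<inter> S')"
  shows "slice A T f * slice A U g \<le> slice A (T \<union> U) h * slice A (T \<inter> U) k"
proof -
  define r where "r = (\<lambda>T f S. if S \<inter> A = T then f S * m S else (0::real))"
  have r: "slice A T f = sum (r T f) (Pow N)" for T f
    unfolding slice_def r_def using finite_N by (subst sum.inter_filter[symmetric]) auto
  show ?thesis unfolding r
  proof (rule four_functions[OF finite_N])
    fix S S' assume S: "S \<subseteq> N" "S' \<subseteq> N"
    show "r T f S * r U g S' \<le> r (T \<union> U) h (S \<union> S') * r (T \<inter> U) k (S \<inter> S')"
    proof (cases "S \<inter> A = T \<and> S' \<inter> A = U")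
      case True
      then have "(S \<union> S') \<inter> A = T \<union> U" "S \<inter> S' \<inter> A = T \<inter> U" by auto
      moreover have "(f S * g S') * (m S * m S') \<le> (h (S \<union> S') * k (S \<inter> S')) * (m (S \<union> S') * m (S \<inter> S'))"
        using S by (intro mult_mono le supermodular mult_nonneg_nonneg nn m_nonneg)
      ultimately show ?thesis using True by (simp add: r_def mult_ac)
    next
      case False
      then show ?thesis using nn m_nonneg by (auto simp: r_def)
    qed
  qed (auto simp: r_def nn m_nonneg)
qed

text \<open>So the law of \<open>S \<inter> A\<close> is again log-supermodular.\<close>

lemma mass_supermodular: "mass A T * mass A U \<le> mass A (T \<union> U) * mass A (T \<inter> U)"
  by (rule slice_four_functions) auto

text \<open>After cross-multiplication this is \<open>slice_four_functions\<close>, with the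
  indicator carried over to the union and 1 to the intersection.\<close>

lemma ind_mean_mono:
  assumes "T \<subseteq> U" "0 < mass A T" "0 < mass A U"
  shows "slice A T (ind i) / mass A T \<le> slice A U (ind i) / mass A U"
proof -
  have "slice A T (ind i) * mass A U \<le> slice A (T \<union> U) (ind i) * mass A (T \<inter> U)"
    by (rule slice_four_functions) auto
  then show ?thesis using assms by (simp add: Un_absorb1 Int_absorb2 field_simps)
qed

text \<open>The conditional means of two coordinates are both monotone functions of the additionally
  observed ones, hence positively correlated.\<close>

lemma condcov_ind_antimono:
  assumes "A \<subseteq> B" "finite B"
  shows "condcov B (ind i) (ind j) \<le> condcov A (ind i) (ind j)"
proof -
  have finA: "finite A" using assms finite_subset by auto
  \<comment> \<open>By the law of total covariance only the integrated product of conditional means,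
    \<open>q\<close>, depends on the pinned set; it remains to see that refinement increases it
    slice by slice.\<close>
  define q where "q A T = slice A T (ind i) * slice A T (ind j) / mass A T" for A T
  have q_nonneg: "0 \<le> q A T" for A T
    unfolding q_def by (intro divide_nonneg_nonneg mult_nonneg_nonneg slice_nonneg) auto
  have q_le: "q A T \<le> (\<Sum>U | U \<subseteq> B \<and> U \<inter> A = T. q B U)" for T
  proof -
    \<comment> \<open>Cuts sums over all subsets of \<open>B\<close> down to those refining the
      event \<open>S \<inter> A = T\<close>.\<close>
    define r where "r = (\<lambda>F U. if U \<inter> A = T then F U else (0::real))"
    have sum_r: "(\<Sum>U | U \<subseteq> B \<and> U \<inter> A = T. F U) = sum (r F) (Pow B)" for F
      unfolding r_def using assms by (subst sum.inter_filter[symmetric]) auto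
    \<comment> \<open>The left factors add up to slices at \<open>A\<close> and the last factor to
      \<open>mass A T\<close>; dividing by it gives the claim on \<open>q\<close>.\<close>
    have "sum (r (\<lambda>U. slice B U (ind i))) (Pow B) * sum (r (\<lambda>U. slice B U (ind j))) (Pow B)
        \<le> sum (r (q B)) (Pow B) * sum (r (mass B)) (Pow B)"
    proof (rule four_functions[OF assms(2)])
      fix U V assume UV: "U \<subseteq> B" "V \<subseteq> B"
      have "slice B U (ind i) * slice B V (ind j) \<le> q B (U \<union> V) * mass B (U \<inter> V)"
      proof (cases "mass B U = 0 \<or> mass B V = 0")
        case True
        then have "slice B U (ind i) * slice B V (ind j) = 0"
          using slice_eq_0_if_mass_eq_0 by auto
        moreover have "0 \<le> q B (U \<union> V) * mass B (U \<inter> V)"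
          using q_nonneg mass_nonneg by (rule mult_nonneg_nonneg)
        ultimately show ?thesis by linarith
      next
        case False
        then have pos: "0 < mass B U" "0 < mass B V"
          using mass_nonneg by (simp_all add: less_le)
        then have "0 < mass B (U \<union> V) * mass B (U \<inter> V)"
          using mass_supermodular[of B U V] by (smt (verit) mult_pos_pos)
        then have pos': "0 < mass B (U \<union> V)"
          using mass_nonneg by (smt (verit) mult_nonneg_nonneg zero_less_mult_pos2 mult_eq_0_iff)
        have nn: "0 \<le> slice B W (ind k)" for W k by (rule slice_nonneg) simp
        have "slice B U (ind i) * slice B V (ind j)
            = (mass B U * mass B V) * ((slice B U (ind i) / mass B U) * (slice B V (ind j) / mass B V))"
          using pos by simp
        \<comment> \<open>Both conditional means are raised to their values at
          \<open>U \<union> V\<close>, and the masses are compared by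
          \<open>mass_supermodular\<close>.\<close>
        also have "\<dots> \<le> (mass B (U \<union> V) * mass B (U \<inter> V)) *
            ((slice B (U \<union> V) (ind i) / mass B (U \<union> V)) * (slice B (U \<union> V) (ind j) / mass B (U \<union> V)))"
          using pos pos'
          by (intro mult_mono mass_supermodular ind_mean_mono mult_nonneg_nonneg divide_nonneg_nonneg
              nn mass_nonneg) auto
        also have "\<dots> = q B (U \<union> V) * mass B (U \<inter> V)"
          using pos' by (simp add: q_def)
        finally show ?thesis .
      qed
      moreover have "0 \<le> q B (U \<union> V) * mass B (U \<inter> V)"
        using q_nonneg mass_nonneg by simp
      moreover have "(U \<union> V) \<inter> A = T \<and> U \<inter> V \<inter> A = T" if "U \<inter> A = T" "V \<inter> A = T"
        using that by auto
      ultimately show "r (\<lambda>U. slice B U (ind i)) U * r (\<lambda>U. slice B U (ind j)) V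
          \<le> r (q B) (U \<union> V) * r (mass B) (U \<inter> V)"
        using q_nonneg mass_nonneg by (auto simp: r_def)
    qed (auto simp: r_def q_nonneg intro!: slice_nonneg)
    then have "slice A T (ind i) * slice A T (ind j)
        \<le> (\<Sum>U | U \<subseteq> B \<and> U \<inter> A = T. q B U) * mass A T"
      by (simp add: sum_r slice_refine[OF assms])
    moreover have "0 \<le> (\<Sum>U | U \<subseteq> B \<and> U \<inter> A = T. q B U)"
      using q_nonneg by (simp add: sum_nonneg)
    ultimately show ?thesis
      using mass_nonneg[of A T] by (cases "mass A T = 0") (auto simp: q_def field_simps)
  qed
  have "(\<Sum>T\<in>Pow A. q A T) \<le> (\<Sum>T\<in>Pow A. \<Sum>U | U \<in> Pow B \<and> U \<inter> A = T. q B U)"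
    using q_le by (intro sum_mono) auto
  also have "\<dots> = (\<Sum>U\<in>Pow B. q B U)"
    using assms finA by (intro sum.group) auto
  finally show ?thesis
    using assms finA by (simp add: condcov_def sum_subtractf sum_slice q_def)
qed

section \<open>Linearity of \<open>condcov\<close> and the effect of pinning one coordinate\<close>

lemma condcov_commute: "condcov A f g = condcov A g f"
  by (simp add: condcov_def mult.commute)

lemma condcov_sum_right: "condcov A f (\<lambda>S. \<Sum>k\<in>K. g k S) = (\<Sum>k\<in>K. condcov A f (g k))"
proof -
  have "condcov A f (\<lambda>S. \<Sum>k\<in>K. g k S)
      = (\<Sum>T\<in>Pow A. \<Sum>k\<in>K. slice A T (\<lambda>S. f S * g k S) - slice A T f * slice A T (g k) / mass A T)"
    by (simp only: condcov_def sum_distrib_left sum_divide_distrib slice_sum sum_subtractf)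
  also have "\<dots> = (\<Sum>k\<in>K. condcov A f (g k))"
    unfolding condcov_def by (rule sum.swap)
  finally show ?thesis .
qed

lemma condcov_cong:
  assumes "\<And>S. S \<subseteq> N \<Longrightarrow> f S = f' S" "\<And>S. S \<subseteq> N \<Longrightarrow> g S = g' S"
  shows "condcov A f g = condcov A f' g'"
proof -
  have "slice A T (\<lambda>S. f S * g S) = slice A T (\<lambda>S. f' S * g' S)" "slice A T f = slice A T f'"
    "slice A T g = slice A T g'" for T
    using assms by (auto intro: slice_cong)
  then show ?thesis by (simp only: condcov_def)
qed

text \<open>A coordinate in \<open>A\<close> is constant on each conditioning event.\<close>

lemma condcov_ind_observed:
  assumes "k \<in> A"
  shows "condcov A f (ind k) = 0"
  unfolding condcov_def
proof (rule sum.neutral, rule)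
  fix T assume "T \<in> Pow A"
  have "slice A T (\<lambda>S. f S * ind k S) = of_bool (k \<in> T) * slice A T f" for f
    unfolding slice_def sum_distrib_left using assms by (intro sum.cong) auto
  from this[of f] this[of "\<lambda>_. 1"]
  show "slice A T (\<lambda>S. f S * ind k S) - slice A T f * slice A T (ind k) / mass A T = 0"
    using slice_eq_0_if_mass_eq_0[of A T f] by (cases "mass A T = 0") auto
qed

lemma condcov_ind_self_nonneg: "0 \<le> condcov A (ind k) (ind k)"
  unfolding condcov_def
proof (rule sum_nonneg)
  fix T
  have "slice A T (ind k) \<le> mass A T" "0 \<le> slice A T (ind k)"
    by (auto intro: slice_mono slice_nonneg)
  then have "slice A T (ind k) * slice A T (ind k) \<le> slice A T (ind k) * mass A T"
    by (intro mult_left_mono) auto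
  then show "0 \<le> slice A T (\<lambda>S. ind k S * ind k S) - slice A T (ind k) * slice A T (ind k) / mass A T"
    using mass_nonneg[of A T] slice_eq_0_if_mass_eq_0[of A T]
    by (cases "mass A T = 0") (auto simp: field_simps simp flip: of_bool_conj)
qed

text \<open>Sums \<open>variance_drop_aux\<close> over the slices, each split according to whether
  \<open>k\<close> belongs to \<open>S\<close>. One \<open>c\<close> serves all slices, and the
  total mass 1 turns the terms \<open>c^2 (s + t)\<close> into \<open>c^2\<close>.\<close>

lemma condcov_self_drop:
  assumes "A \<subseteq> N" "k \<in> N - A"
  shows "4 * (2 * c * condcov A f (ind k) - c\<^sup>2) \<le> condcov A f f - condcov (insert k A) f f"
proof -
  have fin: "finite A" "finite (insert k A)" "k \<notin> A" using assms finite_N finite_subset by auto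
  define a where "a T = slice (insert k A) T f" for T
  define b where "b T = slice (insert k A) (insert k T) f" for T
  define s where "s T = mass (insert k A) T" for T
  define t where "t T = mass (insert k A) (insert k T)" for T
  have split: "slice A T f = a T + b T" "mass A T = s T + t T"
    "slice A T (\<lambda>S. f S * ind k S) = b T" "slice A T (ind k) = t T" if "T \<subseteq> A" for T
    using slice_insert[OF fin(3) that] unfolding a_def b_def s_def t_def
    by (simp_all add: slice_add[symmetric] algebra_simps)
  have "4 * (2 * c * condcov A f (ind k) - c\<^sup>2)
      = 4 * (2 * c * condcov A f (ind k) - c\<^sup>2 * (\<Sum>T\<in>Pow A. mass A T))"
    using fin by (simp add: sum_slice sum_m)
  also have "\<dots> = (\<Sum>T\<in>Pow A. 4 * (2 * c * (b T - (a T + b T) * t T / (s T + t T)) - c\<^sup>2 * (s T + t T)))"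
    unfolding condcov_def sum_distrib_left sum_subtractf[symmetric]
    by (intro sum.cong refl) (simp add: split)
  also have "\<dots> \<le> (\<Sum>T\<in>Pow A. a T * a T / s T + b T * b T / t T
      - (a T + b T) * (a T + b T) / (s T + t T))"
    unfolding a_def b_def s_def t_def
    by (intro sum_mono variance_drop_aux mass_nonneg; erule slice_eq_0_if_mass_eq_0)
  also have "\<dots> = (\<Sum>T\<in>Pow (insert k A). slice (insert k A) T f * slice (insert k A) T f / mass (insert k A) T)
      - (\<Sum>T\<in>Pow A. slice A T f * slice A T f / mass A T)"
    unfolding sum_Pow_insert[OF fin(1,3)] sum_subtractf[symmetric]
    by (intro sum.cong refl) (simp add: split a_def b_def s_def t_def)
  also have "\<dots> = condcov A f f - condcov (insert k A) f f"
    using fin by (simp add: condcov_def sum_subtractf sum_slice)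
  finally show ?thesis .
qed

subsection \<open>The variance of the number of ones under random pinning\<close>

definition size_var :: "'a set \<Rightarrow> real" where
  "size_var A = condcov A (\<lambda>S. real (card S)) (\<lambda>S. real (card S))"

lemma card_eq_sum_ind:
  assumes "S \<subseteq> N"
  shows "real (card S) = (\<Sum>k\<in>N. ind k S)"
proof -
  have "(\<Sum>k\<in>N. ind k S) = real (card (N \<inter> S))"
    using finite_N by (simp only: sum_of_bool_eq Collect_mem_eq)
  then show ?thesis using assms by (simp only: Int_absorb1)
qed

lemma size_var_eq_sum: "size_var A = (\<Sum>k\<in>N - A. condcov A (\<lambda>S. real (card S)) (ind k))"
proof -
  have "size_var A = condcov A (\<lambda>S. real (card S)) (\<lambda>S. \<Sum>k\<in>N. ind k S)"
    unfolding size_var_def by (intro condcov_cong card_eq_sum_ind refl)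
  also have "\<dots> = (\<Sum>k\<in>N. condcov A (\<lambda>S. real (card S)) (ind k))"
    by (rule condcov_sum_right)
  also have "\<dots> = (\<Sum>k\<in>N - A. condcov A (\<lambda>S. real (card S)) (ind k))"
    using finite_N by (intro sum.mono_neutral_right) (auto simp: condcov_ind_observed)
  finally show ?thesis .
qed

lemma size_var_eq_sum_pairs: "size_var A = (\<Sum>i\<in>N. \<Sum>j\<in>N. condcov A (ind i) (ind j))"
proof -
  have "size_var A = condcov A (\<lambda>S. \<Sum>k\<in>N. ind k S) (\<lambda>S. \<Sum>k\<in>N. ind k S)"
    unfolding size_var_def by (intro condcov_cong card_eq_sum_ind)
  also have "\<dots> = (\<Sum>j\<in>N. \<Sum>i\<in>N. condcov A (ind j) (ind i))"
    unfolding condcov_sum_right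
    by (subst condcov_commute) (simp add: condcov_sum_right)
  finally show ?thesis .
qed

text \<open>With the same \<open>c\<close> for every \<open>k\<close>, the covariances add up to
  \<open>size_var A\<close>, so the bound involves no other unknown than the variance.\<close>

lemma size_var_drop:
  assumes "A \<subseteq> N"
  shows "4 * (2 * c * size_var A - c\<^sup>2 * card (N - A)) \<le> (\<Sum>k\<in>N - A. size_var A - size_var (insert k A))"
proof -
  have "4 * (2 * c * size_var A - c\<^sup>2 * card (N - A))
      = (\<Sum>k\<in>N - A. 4 * (2 * c * condcov A (\<lambda>S. real (card S)) (ind k) - c\<^sup>2))"
    unfolding size_var_eq_sum[of A]
    by (simp add: sum_subtractf flip: sum_distrib_left)
  also have "\<dots> \<le> (\<Sum>k\<in>N - A. size_var A - size_var (insert k A))"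
    unfolding size_var_def using assms by (intro sum_mono condcov_self_drop)
  finally show ?thesis .
qed

text \<open>Averages \<open>size_var_drop\<close> over \<open>A\<close> by means of the derivative
  formula; as that bound is linear in \<open>size_var\<close>, a single \<open>c\<close> serves all
  \<open>A\<close>.\<close>

lemma bernoulli_avg_size_var_deriv:
  fixes p :: real
  assumes "N \<noteq> {}" "0 \<le> p" "p < 1"
  defines "V \<equiv> bernoulli_avg N size_var"
  shows "\<exists>D. (V has_real_derivative D) (at p) \<and> D \<le> - 4 * (V p)\<^sup>2 / (card N * (1 - p)\<^sup>2)"
proof (intro exI conjI)
  define W where "W = bernoulli_avg N (\<lambda>A. \<Sum>k\<in>N - A. size_var (insert k A) - size_var A) p"
  define K where "K = card N * (1 - p)"
  have "card N > 0" using assms(1) finite_N by (simp add: card_gt_0_iff)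
  then have K: "K > 0" using assms by (simp add: K_def)
  \<comment> \<open>This \<open>c\<close> maximises \<open>2 c V p - c^2 K\<close>, where
    \<open>K\<close> is the mean number of unpinned coordinates.\<close>
  define c where "c = V p / K"
  show "(V has_real_derivative W / (1 - p)) (at p)"
    unfolding V_def W_def using assms finite_N by (intro has_real_derivative_bernoulli_avg) auto
  have "W \<le> bernoulli_avg N (\<lambda>A. 4 * (c\<^sup>2 * card (N - A) - 2 * c * size_var A)) p"
    unfolding W_def
  proof (rule bernoulli_avg_mono)
    fix A assume "A \<subseteq> N"
    from size_var_drop[OF this, of c]
    show "(\<Sum>k\<in>N - A. size_var (insert k A) - size_var A)
        \<le> 4 * (c\<^sup>2 * card (N - A) - 2 * c * size_var A)"
      by (simp add: sum_subtractf)
  qed (use assms in auto)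
  also have "\<dots> = 4 * (c\<^sup>2 * K - 2 * c * V p)"
    using finite_N by (simp add: bernoulli_avg_cmult bernoulli_avg_diff bernoulli_avg_card_compl V_def K_def)
  also have "\<dots> = - 4 * (V p)\<^sup>2 / K"
    using K by (simp add: c_def power2_eq_square field_simps)
  finally have "W / (1 - p) \<le> - 4 * (V p)\<^sup>2 / K / (1 - p)"
    using assms by (intro divide_right_mono) auto
  then show "W / (1 - p) \<le> - 4 * (V p)\<^sup>2 / (card N * (1 - p)\<^sup>2)"
    by (simp add: K_def power2_eq_square mult_ac)
qed

text \<open>Integrates the differential inequality for \<open>1 / V\<close> over the interval from 0
  to 1/2. Arguing by contradiction supplies the positivity of \<open>V\<close> that the reciprocal
  requires.\<close>

lemma bernoulli_avg_size_var_half: "bernoulli_avg N size_var (1 / 2) \<le> card N / 4"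
proof (cases "N = {}")
  case True
  have "size_var A = 0" for A
    unfolding size_var_eq_sum_pairs using True by (simp only: sum.empty)
  then show ?thesis by (simp only: bernoulli_avg_def mult_zero_right sum.neutral_const)
next
  case False
  define V where "V = bernoulli_avg N size_var"
  have n: "real (card N) > 0" using False finite_N by (simp add: card_gt_0_iff)
  show ?thesis
  proof (rule ccontr)
    assume "\<not> ?thesis"
    then have "V (1 / 2) > card N / 4" by (simp add: V_def)
    then have half: "V (1 / 2) > card N / 4" "V (1 / 2) > 0" using n by auto
    \<comment> \<open>\<open>V\<close> is nonincreasing, so positivity at 1/2 extends to the whole
      interval.\<close>
    have pos: "V p > 0" if "0 \<le> p" "p \<le> 1 / 2" for p
    proof -
      have "V (1 / 2) \<le> V p"
      proof (rule DERIV_nonpos_imp_nonincreasing[OF that(2)])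
        fix x assume "p \<le> x" "x \<le> 1 / 2"
        then have "0 \<le> x" "x < 1" using that by auto
        then obtain D where "(V has_real_derivative D) (at x)"
          "D \<le> - 4 * (V x)\<^sup>2 / (card N * (1 - x)\<^sup>2)"
          using bernoulli_avg_size_var_deriv[OF False, of x] unfolding V_def by blast
        moreover have "- 4 * (V x)\<^sup>2 / (card N * (1 - x)\<^sup>2) \<le> 0"
          by (intro divide_nonpos_nonneg) auto
        ultimately show "\<exists>D. (V has_real_derivative D) (at x) \<and> D \<le> 0"
          by (blast intro: order_trans)
      qed
      then show ?thesis using half by simp
    qed
    have "1 / V 0 - 4 / card N \<le> 1 / V (1 / 2) - 4 / card N / (1 - 1 / 2)"
    proof -
      \<comment> \<open>The derivative of \<open>1 / V\<close> is \<open>- V' / V^2\<close>, which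
        is at least that of \<open>4 / (n (1 - p))\<close>.\<close>
      define h where "h = (\<lambda>p. 1 / V p - 4 / card N / (1 - p))"
      have "h 0 \<le> h (1 / 2)"
      proof (rule DERIV_nonneg_imp_nondecreasing[where f = h])
        fix x :: real assume x: "0 \<le> x" "x \<le> 1 / 2"
        then have "x < 1" by simp
        with x obtain D where D: "(V has_real_derivative D) (at x)"
          "D \<le> - 4 * (V x)\<^sup>2 / (card N * (1 - x)\<^sup>2)"
          using bernoulli_avg_size_var_deriv[OF False, of x] unfolding V_def by blast
        have Vx: "V x > 0" using pos x by simp
        have "(h has_real_derivative - D / (V x)\<^sup>2 - 4 / card N / (1 - x)\<^sup>2) (at x)"
          unfolding h_def using Vx x n
          by (auto intro!: derivative_eq_intros D(1) simp: power2_eq_square)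
        moreover have "4 / card N / (1 - x)\<^sup>2 \<le> - D / (V x)\<^sup>2"
        proof -
          have "4 * (V x)\<^sup>2 / (card N * (1 - x)\<^sup>2) / (V x)\<^sup>2 \<le> - D / (V x)\<^sup>2"
            using D(2) by (intro divide_right_mono) auto
          then show ?thesis using Vx by simp
        qed
        ultimately show "\<exists>y. (h has_real_derivative y) (at x) \<and> 0 \<le> y" by force
      qed simp
      then show ?thesis by (simp add: h_def)
    qed
    moreover have "1 / V 0 > 0" using pos[of 0] by simp
    \<comment> \<open>The subtracted term grows from \<open>4 / n\<close> at 0 to
      \<open>8 / n\<close> at 1/2, which leaves \<open>1 / V (1/2) > 4 / n\<close>.\<close>
    moreover have "4 / card N / (1 - 1 / 2) = 2 * (4 / card N)" by simp
    ultimately have "4 / card N < 1 / V (1 / 2)" by linarith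
    then show False using half n by (simp add: field_simps)
  qed
qed

text \<open>Compares with the sum of \<open>size_var\<close> over all pinned sets, that is, with the
  average at \<open>p = 1/2\<close>. A pair is unpinned in a quarter of these sets, and there its
  covariance is at least the fully conditioned one.\<close>

lemma sum_condcov_pairs_le:
  "(\<Sum>i\<in>N. \<Sum>j\<in>N - {i}. condcov (N - {i, j}) (ind i) (ind j)) \<le> card N"
proof -
  define C where "C i j = condcov (N - {i, j}) (ind i) (ind j)" for i j
  have fN: "finite (Pow N)" using finite_N by simp
  have pair: "2 ^ card N / 4 * C i j \<le> (\<Sum>A\<in>Pow N. condcov A (ind i) (ind j))"
    if ij: "i \<in> N" "j \<in> N - {i}" for i j
  proof -
    have "card N = card (N - {i, j}) + 2"
      using ij finite_N card_Diff_subset[of "{i, j}" N] card_mono[of N "{i, j}"] by auto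
    then have "2 ^ card N / 4 * C i j = (\<Sum>A\<in>Pow (N - {i, j}). C i j)"
      using finite_N by (simp add: card_Pow power_add)
    also have "\<dots> \<le> (\<Sum>A\<in>Pow (N - {i, j}). condcov A (ind i) (ind j))"
      unfolding C_def using finite_N by (intro sum_mono condcov_ind_antimono) auto
    also have "\<dots> = (\<Sum>A\<in>Pow N. condcov A (ind i) (ind j))"
    proof (rule sum.mono_neutral_left[OF fN])
      show "\<forall>A\<in>Pow N - Pow (N - {i, j}). condcov A (ind i) (ind j) = 0"
      proof
        fix A assume "A \<in> Pow N - Pow (N - {i, j})"
        then have "i \<in> A \<or> j \<in> A" by auto
        then show "condcov A (ind i) (ind j) = 0"
          using condcov_ind_observed condcov_commute by metis
      qed
    qed auto
    finally show ?thesis .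
  qed
  have "2 ^ card N / 4 * (\<Sum>i\<in>N. \<Sum>j\<in>N - {i}. C i j)
      \<le> (\<Sum>i\<in>N. \<Sum>j\<in>N - {i}. \<Sum>A\<in>Pow N. condcov A (ind i) (ind j))"
    unfolding sum_distrib_left by (intro sum_mono pair)
  \<comment> \<open>The added diagonal terms are mean conditional variances, hence
    nonnegative.\<close>
  also have "\<dots> \<le> (\<Sum>i\<in>N. \<Sum>j\<in>N. \<Sum>A\<in>Pow N. condcov A (ind i) (ind j))"
  proof (rule sum_mono)
    fix i assume "i \<in> N"
    then show "(\<Sum>j\<in>N - {i}. \<Sum>A\<in>Pow N. condcov A (ind i) (ind j))
        \<le> (\<Sum>j\<in>N. \<Sum>A\<in>Pow N. condcov A (ind i) (ind j))"
      using finite_N by (simp add: sum.remove[of N i] sum_nonneg condcov_ind_self_nonneg)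
  qed
  also have "\<dots> = (\<Sum>i\<in>N. \<Sum>A\<in>Pow N. \<Sum>j\<in>N. condcov A (ind i) (ind j))"
    by (intro sum.cong refl sum.swap)
  also have "\<dots> = (\<Sum>A\<in>Pow N. size_var A)"
    unfolding size_var_eq_sum_pairs by (rule sum.swap)
  also have "\<dots> \<le> 2 ^ card N / 4 * card N"
    using bernoulli_avg_size_var_half finite_N by (simp add: bernoulli_avg_half field_simps)
  finally show ?thesis unfolding C_def by simp
qed

lemma slice_inds_ge:
  "slice A T (ind i) * slice A T (ind j) \<le> slice A T (\<lambda>S. ind i S * ind j S) * mass A T"
  using slice_four_functions[of "ind i" "ind j" "\<lambda>S. ind i S * ind j S" "\<lambda>_. 1" A T T] by simp

end

subsection \<open>From random vectors to laws on subsets\<close>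

lemma (in prob_space) integral_finite_image:
  fixes h :: "'b \<Rightarrow> real"
  assumes "finite F" and Y: "Y \<in> measurable M (count_space F)"
  shows "(LINT \<omega>|M. h (Y \<omega>)) = (\<Sum>S\<in>F. h S * prob {\<omega>\<in>space M. Y \<omega> = S})"
proof -
  have sets: "{\<omega>\<in>space M. Y \<omega> = S} \<in> events" if "S \<in> F" for S
    using measurable_sets[OF Y, of "{S}"] that by (simp add: vimage_def Int_def conj_commute)
  have "(LINT \<omega>|M. h (Y \<omega>)) = (LINT \<omega>|M. (\<Sum>S\<in>F. h S * indicator {\<omega>'\<in>space M. Y \<omega>' = S} \<omega>))"
  proof (rule Bochner_Integration.integral_cong[OF refl])
    fix \<omega> assume "\<omega> \<in> space M"
    moreover from this have "Y \<omega> \<in> F" using measurable_space[OF Y] by simp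
    moreover have "(\<Sum>S\<in>F. h S * indicator {\<omega>\<in>space M. Y \<omega> = S} \<omega>)
        = (\<Sum>S\<in>F. if S = Y \<omega> then h S else 0)"
      using \<open>\<omega> \<in> space M\<close> by (intro sum.cong) auto
    ultimately show "h (Y \<omega>) = (\<Sum>S\<in>F. h S * indicator {\<omega>\<in>space M. Y \<omega> = S} \<omega>)"
      using assms(1) by simp
  qed
  also have "\<dots> = (\<Sum>S\<in>F. h S * prob {\<omega>\<in>space M. Y \<omega> = S})"
    using sets by (subst Bochner_Integration.integral_sum) (auto simp: integrable_indicator_iff emeasure_eq_measure)
  finally show ?thesis .
qed

lemma (in prob_space) integral_uniform_measure_finite_image:
  fixes h :: "'b \<Rightarrow> real"
  assumes F: "finite F" and Y: "Y \<in> measurable M (count_space F)"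
    and pos: "prob {\<omega>\<in>space M. Y \<omega> \<in> W} > 0"
  shows "(LINT \<omega>|uniform_measure M {\<omega>\<in>space M. Y \<omega> \<in> W}. h (Y \<omega>)) =
    (\<Sum>S\<in>F \<inter> W. h S * prob {\<omega>\<in>space M. Y \<omega> = S}) / prob {\<omega>\<in>space M. Y \<omega> \<in> W}"
proof -
  let ?E = "{\<omega>\<in>space M. Y \<omega> \<in> W}"
  have [measurable]: "?E \<in> events" using pos measure_notin_sets by force
  have [measurable]: "(\<lambda>\<omega>. h (Y \<omega>)) \<in> borel_measurable M"
    by (rule measurable_compose[OF Y]) simp
  \<comment> \<open>The density is rewritten as the \<open>ennreal\<close> of a real quotient, the
    form to which \<open>integral_density\<close> applies.\<close>
  have "uniform_measure M ?E = density M (\<lambda>\<omega>. ennreal (indicator ?E \<omega> / prob ?E))"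
    unfolding uniform_measure_def using pos
    by (intro density_cong) (auto simp: emeasure_eq_measure divide_ennreal[symmetric] split: split_indicator)
  then have "(LINT \<omega>|uniform_measure M ?E. h (Y \<omega>))
      = (LINT \<omega>|M. (indicator ?E \<omega> / prob ?E) *\<^sub>R h (Y \<omega>))"
    by (simp only:) (subst integral_density, auto)
  also have "\<dots> = (LINT \<omega>|M. indicator W (Y \<omega>) * h (Y \<omega>) / prob ?E)"
    by (intro Bochner_Integration.integral_cong refl) (auto split: split_indicator)
  also have "\<dots> = (\<Sum>S\<in>F. indicator W S * h S / prob ?E * prob {\<omega>\<in>space M. Y \<omega> = S})"
    by (rule integral_finite_image[OF F Y])
  also have "\<dots> = (\<Sum>S\<in>F. if S \<in> W then h S * prob {\<omega>\<in>space M. Y \<omega> = S} / prob ?E else 0)"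
    by (intro sum.cong) auto
  also have "\<dots> = (\<Sum>S\<in>F \<inter> W. h S * prob {\<omega>\<in>space M. Y \<omega> = S}) / prob ?E"
    using F by (auto simp: sum.inter_restrict sum_divide_distrib intro!: sum.cong)
  finally show ?thesis .
qed

lemma covariance_cong:
  assumes "\<And>\<omega>. \<omega> \<in> space M \<Longrightarrow> Y \<omega> = Y' \<omega>" "\<And>\<omega>. \<omega> \<in> space M \<Longrightarrow> Z \<omega> = Z' \<omega>"
  shows "covariance M Y Z = covariance M Y' Z'"
proof -
  have "integral\<^sup>L M Y = integral\<^sup>L M Y'" "integral\<^sup>L M Z = integral\<^sup>L M Z'"
    using assms by (auto intro: Bochner_Integration.integral_cong)
  then show ?thesis unfolding covariance_def
    using assms by (intro Bochner_Integration.integral_cong) auto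
qed

text \<open>\<open>L\<close> is the counterpart of \<open>slice\<close>: multiplied by the mass
  \<open>L (\<lambda>_. 1)\<close>, the right-hand side has the form of a summand of
  \<open>condcov\<close>.\<close>

lemma (in prob_space) covariance_uniform_measure_finite_image:
  fixes f g :: "'b \<Rightarrow> real" and W :: "'b set"
  assumes F: "finite F" and Y: "Y \<in> measurable M (count_space F)"
  defines "L \<equiv> \<lambda>h. \<Sum>S\<in>F \<inter> W. h S * prob {\<omega>\<in>space M. Y \<omega> = S}"
  assumes pos: "L (\<lambda>_. 1) > 0"
  shows "covariance (uniform_measure M {\<omega>\<in>space M. Y \<omega> \<in> W}) (\<lambda>\<omega>. f (Y \<omega>)) (\<lambda>\<omega>. g (Y \<omega>)) =
    (L (\<lambda>S. f S * g S) - L f * L g / L (\<lambda>_. 1)) / L (\<lambda>_. 1)"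
proof -
  let ?E = "{\<omega>\<in>space M. Y \<omega> \<in> W}"
  have E: "?E \<in> events"
    using measurable_sets[OF Y, of "F \<inter> W"] measurable_space[OF Y]
    by (auto simp: vimage_def Int_def conj_commute cong: conj_cong)
  have "prob ?E = (LINT \<omega>|M. indicator W (Y \<omega>))"
  proof -
    have "(LINT \<omega>|M. indicator W (Y \<omega>)) = (LINT \<omega>|M. indicator ?E \<omega> :: real)"
      by (intro Bochner_Integration.integral_cong) (auto split: split_indicator)
    then show ?thesis using E by simp
  qed
  also have "\<dots> = (\<Sum>S\<in>F. indicator W S * prob {\<omega>\<in>space M. Y \<omega> = S})"
    by (rule integral_finite_image[OF F Y])
  also have "\<dots> = L (\<lambda>_. 1)"
    unfolding L_def sum.inter_restrict[OF F] by (intro sum.cong) auto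
  finally have prob_E: "prob ?E = L (\<lambda>_. 1)" .
  have "prob ?E > 0" using pos prob_E by simp
  then have int: "(LINT \<omega>|uniform_measure M ?E. h (Y \<omega>)) = L h / L (\<lambda>_. 1)" for h :: "'b \<Rightarrow> real"
    by (simp only: integral_uniform_measure_finite_image[OF F Y] prob_E) (simp add: L_def)
  define a b where "a = L f / L (\<lambda>_. 1)" and "b = L g / L (\<lambda>_. 1)"
  have "covariance (uniform_measure M ?E) (\<lambda>\<omega>. f (Y \<omega>)) (\<lambda>\<omega>. g (Y \<omega>))
      = L (\<lambda>S. (f S - a) * (g S - b)) / L (\<lambda>_. 1)"
    unfolding covariance_def int a_def[symmetric] b_def[symmetric] by (rule int)
  also have "L (\<lambda>S. (f S - a) * (g S - b)) = L (\<lambda>S. f S * g S) - a * L g - b * L f + a * b * L (\<lambda>_. 1)"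
    unfolding L_def sum_distrib_left sum_subtractf[symmetric] sum.distrib[symmetric]
    by (intro sum.cong refl) (simp add: algebra_simps)
  also have "\<dots> = L (\<lambda>S. f S * g S) - L f * L g / L (\<lambda>_. 1)"
    using pos by (simp add: a_def b_def)
  finally show ?thesis .
qed

section \<open>Zero-one vectors as sets of ones\<close>

definition ones :: "nat \<Rightarrow> (nat \<Rightarrow> real) \<Rightarrow> nat set" where
  "ones n x = {k\<in>{1..n}. x k = 1}"

definition of_ones :: "nat \<Rightarrow> nat set \<Rightarrow> nat \<Rightarrow> real" where
  "of_ones n S = (\<lambda>k\<in>{1..n}. of_bool (k \<in> S))"

lemma ones_subset: "ones n x \<subseteq> {1..n}"
  by (auto simp: ones_def)

lemma of_ones_in_cube: "of_ones n S \<in> cube n"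
  by (auto simp: of_ones_def cube_def)

lemma cube_apply:
  assumes "x \<in> cube n" "k \<in> {1..n}"
  shows "x k = of_bool (k \<in> ones n x)"
  using PiE_mem[OF assms(1)[unfolded cube_def] assms(2)] assms(2) by (auto simp: ones_def)

lemma ones_eq_iff:
  assumes "x \<in> cube n" "S \<subseteq> {1..n}"
  shows "ones n x = S \<longleftrightarrow> x = of_ones n S"
proof
  assume S: "ones n x = S"
  have "x k = of_ones n S k" for k
  proof (cases "k \<in> {1..n}")
    case True
    show ?thesis using True unfolding cube_apply[OF assms(1) True] S of_ones_def by simp
  next
    case False
    then have "x k = undefined" using assms(1) unfolding cube_def by (rule PiE_arb[rotated])
    then show ?thesis using False by (simp only: of_ones_def restrict_apply if_False)
  qed
  then show "x = of_ones n S" by (rule ext)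
next
  assume "x = of_ones n S"
  then show "ones n x = S" using assms(2) by (auto simp: ones_def of_ones_def)
qed

text \<open>Translates the conditioning event of \<open>cond_cov\<close> into one about
  \<open>ones n x \<inter> A\<close>.\<close>

lemma restrict_eq_iff_ones:
  assumes "x \<in> cube n" "y \<in> cube n" "A \<subseteq> {1..n}"
  shows "restrict x A = restrict y A \<longleftrightarrow> ones n x \<inter> A = ones n y \<inter> A"
proof -
  have "restrict x A = restrict y A \<longleftrightarrow> (\<forall>k\<in>A. x k = y k)"
    by (metis restrict_apply' restrict_ext)
  also have "\<dots> \<longleftrightarrow> (\<forall>k\<in>A. k \<in> ones n x \<longleftrightarrow> k \<in> ones n y)"
  proof (rule ball_cong[OF refl])
    fix k assume "k \<in> A"
    then have k: "k \<in> {1..n}" using assms(3) by blast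
    show "x k = y k \<longleftrightarrow> (k \<in> ones n x \<longleftrightarrow> k \<in> ones n y)"
      unfolding cube_apply[OF assms(1) k] cube_apply[OF assms(2) k] by simp
  qed
  also have "\<dots> \<longleftrightarrow> ones n x \<inter> A = ones n y \<inter> A" by blast
  finally show ?thesis .
qed

text \<open>Under this identification \<open>MTP2\<close> becomes log-supermodularity on
  subsets.\<close>

lemma vec_min_of_ones: "vec_min n (of_ones n S) (of_ones n T) = of_ones n (S \<inter> T)"
  and vec_max_of_ones: "vec_max n (of_ones n S) (of_ones n T) = of_ones n (S \<union> T)"
  by (auto simp: vec_min_def vec_max_def of_ones_def)

lemma measurable_ones:
  assumes "X \<in> measurable M (count_space (cube n))"
  shows "(\<lambda>\<omega>. ones n (X \<omega>)) \<in> measurable M (count_space (Pow {1..n}))"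
  by (rule measurable_compose[OF assms]) (simp add: ones_subset Pi_I del: One_nat_def)

section \<open>The random vector and its conditional covariances\<close>

locale MTP2_vector = prob_space M for M :: "'w measure" +
  fixes n :: nat and X :: "'w \<Rightarrow> nat \<Rightarrow> real"
  assumes X: "X \<in> measurable M (count_space (cube n))"
    and MTP2: "MTP2 n (distr M (count_space (cube n)) X)"
begin

abbreviation Y :: "'w \<Rightarrow> nat set" where
  "Y \<omega> \<equiv> ones n (X \<omega>)"

abbreviation law :: "nat set \<Rightarrow> real" where
  "law S \<equiv> prob {\<omega>\<in>space M. Y \<omega> = S}"

lemma X_in_cube: "\<omega> \<in> space M \<Longrightarrow> X \<omega> \<in> cube n"
  using measurable_space[OF X] by simp

lemma law_eq:
  assumes "S \<subseteq> {1..n}"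
  shows "law S = measure (distr M (count_space (cube n)) X) {of_ones n S}"
proof -
  have "{\<omega>\<in>space M. Y \<omega> = S} = X -` {of_ones n S} \<inter> space M"
    using ones_eq_iff[OF X_in_cube assms] by blast
  then show ?thesis using X of_ones_in_cube by (simp add: measure_distr)
qed

sublocale log_supermodular "{1..n}" law
proof
  show "sum law (Pow {1..n}) = 1"
    using integral_finite_image[OF finite_Pow_iff[THEN iffD2, OF finite_atLeastAtMost] measurable_ones[OF X],
        of "\<lambda>_. 1"]
    by (simp only: lebesgue_integral_const prob_space mult_1 scaleR_one)
next
  fix S T assume ST: "S \<subseteq> {1..n}" "T \<subseteq> {1..n}"
  then have un: "S \<union> T \<subseteq> {1..n}" "S \<inter> T \<subseteq> {1..n}" by auto
  let ?\<mu> = "measure (distr M (count_space (cube n)) X)"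
  have "?\<mu> {of_ones n S} * ?\<mu> {of_ones n T} \<le> ?\<mu> {of_ones n (S \<inter> T)} * ?\<mu> {of_ones n (S \<union> T)}"
    using MTP2 of_ones_in_cube[of n S] of_ones_in_cube[of n T]
    unfolding MTP2_def vec_min_of_ones[symmetric] vec_max_of_ones[symmetric] by blast
  then show "law S * law T \<le> law (S \<union> T) * law (S \<inter> T)"
    unfolding law_eq[OF ST(1)] law_eq[OF ST(2)] law_eq[OF un(1)] law_eq[OF un(2)]
    by (simp only: mult.commute)
qed auto

text \<open>The conditional covariance is a function of \<open>Y \<omega> \<inter> A\<close> alone,
  so its mean is a sum over slices, where positive association removes the absolute value.\<close>

lemma expectation_abs_cond_cov:
  assumes ij: "i \<in> {1..n}" "j \<in> {1..n}"
  shows "(LINT \<omega>|M. \<bar>cond_cov M n X i j \<omega>\<bar>) = condcov ({1..n} - {i, j}) (ind i) (ind j)"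
proof -
  define A where "A = {1..n} - {i, j}"
  define c where "c T = covariance (uniform_measure M {\<eta>\<in>space M. Y \<eta> \<in> {S. S \<inter> A = T}})
    (\<lambda>\<eta>. ind i (Y \<eta>)) (\<lambda>\<eta>. ind j (Y \<eta>))" for T
  have fin: "finite A" "finite (Pow {1..n})" and sub: "A \<subseteq> {1..n}" by (auto simp: A_def)
  have "cond_cov M n X i j \<omega> = c (Y \<omega> \<inter> A)" if "\<omega> \<in> space M" for \<omega>
  proof -
    have "{\<eta>\<in>space M. restrict (X \<eta>) A = restrict (X \<omega>) A} = {\<eta>\<in>space M. Y \<eta> \<in> {S. S \<inter> A = Y \<omega> \<inter> A}}"
      using that restrict_eq_iff_ones[OF X_in_cube X_in_cube sub] by blast
    then show ?thesis
      unfolding cond_cov_def c_def A_def[symmetric]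
      by (simp only:) (intro covariance_cong cube_apply X_in_cube ij; simp)
  qed
  then have "(LINT \<omega>|M. \<bar>cond_cov M n X i j \<omega>\<bar>) = (LINT \<omega>|M. \<bar>c (Y \<omega> \<inter> A)\<bar>)"
    by (intro Bochner_Integration.integral_cong) auto
  also have "\<dots> = (\<Sum>S\<in>Pow {1..n}. \<bar>c (S \<inter> A)\<bar> * law S)"
    by (rule integral_finite_image[OF fin(2) measurable_ones[OF X]])
  also have "\<dots> = (\<Sum>T\<in>Pow A. slice A T (\<lambda>S. \<bar>c (S \<inter> A)\<bar>))"
    by (rule sum_slice[OF fin(1), symmetric])
  also have "\<dots> = condcov A (ind i) (ind j)"
    unfolding condcov_def
  proof (intro sum.cong refl)
    fix T
    have "slice A T (\<lambda>S. \<bar>c (S \<inter> A)\<bar>) = \<bar>c T\<bar> * mass A T"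
      unfolding slice_def sum_distrib_left by (intro sum.cong) auto
    also have "\<dots> = slice A T (\<lambda>S. ind i S * ind j S) - slice A T (ind i) * slice A T (ind j) / mass A T"
    proof (cases "mass A T = 0")
      \<comment> \<open>On a null slice both sides are 0, whatever \<open>c T\<close> is: its weight
        is 0, and so are the integrals on the right.\<close>
      case True
      then show ?thesis using slice_eq_0_if_mass_eq_0 by simp
    next
      case False
      then have pos: "mass A T > 0" using mass_nonneg[of A T] by simp
      have slice: "slice A T h = (\<Sum>S\<in>Pow {1..n} \<inter> {S. S \<inter> A = T}. h S * law S)" for h
        unfolding slice_def by (intro sum.cong) auto
      have "c T = (slice A T (\<lambda>S. ind i S * ind j S)
          - slice A T (ind i) * slice A T (ind j) / mass A T) / mass A T"
        using covariance_uniform_measure_finite_image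
            [OF fin(2) measurable_ones[OF X], of "{S. S \<inter> A = T}" "ind i" "ind j"] pos
        unfolding c_def slice by blast
      moreover have "0 \<le> slice A T (\<lambda>S. ind i S * ind j S) - slice A T (ind i) * slice A T (ind j) / mass A T"
        using slice_inds_ge[of A T i j] pos by (simp add: pos_divide_le_eq)
      ultimately show ?thesis using pos by simp
    qed
    finally show "slice A T (\<lambda>S. \<bar>c (S \<inter> A)\<bar>)
      = slice A T (\<lambda>S. ind i S * ind j S) - slice A T (ind i) * slice A T (ind j) / mass A T" .
  qed
  finally show ?thesis unfolding A_def .
qed

end

lemma sum_strict_pairs_symmetric:
  fixes C :: "nat \<Rightarrow> nat \<Rightarrow> real"
  assumes "\<And>i j. C i j = C j i"
  shows "2 * (\<Sum>(i, j) | 1 \<le> i \<and> i < j \<and> j \<le> n. C i j) = (\<Sum>i\<in>{1..n}. \<Sum>j\<in>{1..n} - {i}. C i j)"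
proof -
  let ?P = "{(i, j). 1 \<le> i \<and> i < j \<and> j \<le> n}"
  have "?P \<subseteq> {1..n} \<times> {1..n}" by auto
  then have fin: "finite ?P" by (rule finite_subset) simp
  have "(\<Sum>i\<in>{1..n}. \<Sum>j\<in>{1..n} - {i}. C i j) = (\<Sum>(i, j)\<in>(SIGMA i:{1..n}. {1..n} - {i}). C i j)"
    by (subst sum.Sigma) auto
  also have "(SIGMA i:{1..n}. {1..n} - {i}) = ?P \<union> prod.swap ` ?P"
    by (auto simp: image_iff)
  also have "(\<Sum>(i, j)\<in>\<dots>. C i j) = (\<Sum>(i, j)\<in>?P. C i j) + (\<Sum>(i, j)\<in>prod.swap ` ?P. C i j)"
    using fin by (intro sum.union_disjoint) auto
  also have "(\<Sum>(i, j)\<in>prod.swap ` ?P. C i j) = (\<Sum>(i, j)\<in>?P. C i j)"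
    using assms by (subst sum.reindex) (auto simp: inj_on_def case_prod_beta intro!: sum.cong)
  finally show ?thesis by simp
qed

theorem mainTheorem2:
  fixes M :: "'w measure" and n :: nat and X :: "'w \<Rightarrow> nat \<Rightarrow> real"
  assumes "prob_space M"
    and "n \<ge> 1"
    and "X \<in> measurable M (count_space (cube n))"
    and "MTP2 n (distr M (count_space (cube n)) X)"
  shows "(\<Sum>(i, j) | 1 \<le> i \<and> i < j \<and> j \<le> n. LINT \<omega>|M. \<bar>cond_cov M n X i j \<omega>\<bar>) \<le> real n / 2"
proof -
  interpret MTP2_vector M n X
    using assms(1,3,4) by (simp add: MTP2_vector_def MTP2_vector_axioms_def)
  define C where "C i j = condcov ({1..n} - {i, j}) (ind i) (ind j)" for i j
  have "C i j = C j i" for i j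
    unfolding C_def by (subst condcov_commute) (simp add: insert_commute)
  from sum_strict_pairs_symmetric[of C, OF this, of n]
  have "2 * (\<Sum>(i, j) | 1 \<le> i \<and> i < j \<and> j \<le> n. C i j) \<le> real n"
    using sum_condcov_pairs_le by (simp add: C_def)
  moreover have "(\<Sum>(i, j) | 1 \<le> i \<and> i < j \<and> j \<le> n. LINT \<omega>|M. \<bar>cond_cov M n X i j \<omega>\<bar>)
      = (\<Sum>(i, j) | 1 \<le> i \<and> i < j \<and> j \<le> n. C i j)"
    by (intro sum.cong) (auto simp: expectation_abs_cond_cov C_def)
  ultimately show ?thesis by simp
qed

end
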